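(* Let $z=x+iy$, $y>0$, be a simple zero of $H_\tau$ of maximal imaginary height, i.e. every zero $\rho$ of $H_\tau$ satisfies $|\operatorname{Im}\rho|\le y$. Let $\eta\ge\sqrt5\,y$ and put $$L_\eta(\tau;x)=-\operatorname{Im}\frac{H_\tau'}{H_\tau}(x+i\eta).$$ Then $H_\tau(x+i\eta)\neq0$ and $$\mathcal G_\tau(z)\ge\frac{L_\eta(\tau;x)}{\eta}-\frac{2}{\eta^2-y^2}.$$ Consequently, if $y\le y_0$ and $\eta\ge\sqrt5\,y_0$, and if for a constant $G_0>0$ $$L_\eta(\tau;x)\ge\eta\left(G_0+\frac{2}{\eta^2-y_0^2}\right),$$ then $\mathcal G_\tau(z)\ge G_0$.
   Context: For real $\tau$ (heat time), $H_\tau(z)=\int_0^\infty e^{\tau u^2}\Phi(u)\cos(zu)\,\mathrm du$, where $\Phi(u)=\sum_{n\ge1}(2\pi^2n^4e^{9u}-3\pi n^2e^{5u})e^{-\pi n^2e^{4u}}$. $H_\tau$ is an even entire function, real on the real axis; $H_\tau'$ is the derivative in $z$. For a maximal-height zero $z=x+iy$, $y>0$, define $$\mathcal G_\tau(z)=\sum_{\rho\ne z,\bar z}\frac{1}{(\operatorname{Re}\rho-x)^2+4y^2},$$ the sum being over all zeros $\rho$ of $H_\tau$ other than $z,\bar z$, counted with multiplicity. *)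

theory Defs
  imports "HOL-Complex_Analysis.Complex_Analysis"
begin

text \<open>The series starts at \<open>n = 1\<close>; it is indexed here by \<open>k = n - 1\<close>.\<close>

definition Phi :: "real \<Rightarrow> real" where
  "Phi u = (\<Sum>k. let n = real (Suc k) in
      (2 * pi\<^sup>2 * n ^ 4 * exp (9 * u) - 3 * pi * n\<^sup>2 * exp (5 * u)) * exp (- pi * n\<^sup>2 * exp (4 * u)))"

definition H :: "real \<Rightarrow> complex \<Rightarrow> complex" where
  "H \<tau> z = set_lebesgue_integral lborel {0..}
      (\<lambda>u. complex_of_real (exp (\<tau> * u\<^sup>2) * Phi u) * cos (z * complex_of_real u))"

definition L :: "real \<Rightarrow> real \<Rightarrow> real \<Rightarrow> real" where
  "L \<eta> \<tau> x = - Im (deriv (H \<tau>) (Complex x \<eta>) / H \<tau> (Complex x \<eta>))"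

text \<open>Multiplicity is accounted for by weighting each distinct zero with its order.\<close>

definition G :: "real \<Rightarrow> complex \<Rightarrow> real" where
  "G \<tau> z = (\<Sum>\<^sub>\<infinity>\<rho>\<in>{\<rho>. H \<tau> \<rho> = 0} - {z, cnj z}.
      real_of_int (zorder (H \<tau>) \<rho>) / ((Re \<rho> - Re z)\<^sup>2 + 4 * (Im z)\<^sup>2))"

end

theory Submission
  imports Defs "HOL-Real_Asymp.Real_Asymp"
begin

text \<open>
  The idea is to read \<open>L\<close> as a sum over zeros and to compare it with \<open>G\<close> term by term. If
  \<open>H'/H\<close> has a partial fraction expansion over the zeros \<open>\<rho>\<close>, then \<open>- Im (H'/H)\<close> at \<open>x + i\<eta>\<close> is the
  sum of \<open>(\<eta> - Im \<rho>) / ((Re \<rho> - x)\<^sup>2 + (\<eta> - Im \<rho>)\<^sup>2)\<close> with multiplicities. As the zeros are symmetric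
  under conjugation, this term may be averaged with that of \<open>cnj \<rho>\<close>, which gives \<open>pair_kernel\<close>. For
  zeros in the strip \<open>\<bar>Im \<rho>\<bar> \<le> y\<close> and \<open>\<eta> \<ge> sqrt 5 * y\<close> the average is at most \<open>\<eta>\<close> times the summand
  of \<open>G\<close> (lemma \<open>pair_kernel_le\<close>), while the pair \<open>z, cnj z\<close>, excluded from \<open>G\<close>, contributes exactly
  \<open>2\<eta> / (\<eta>\<^sup>2 - y\<^sup>2)\<close>. Dividing by \<open>\<eta>\<close> gives the bound. The same terms also dominate a positive
  multiple of the summands of \<open>G\<close> (lemma \<open>pair_kernel_ge\<close>), so the sum defining \<open>G\<close> converges; this
  is necessary because a divergent \<open>infsum\<close> has the value \<open>0\<close>.

  The partial fraction expansion is obtained without Hadamard products. Divide an entire function \<open>f\<close>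
  by the polynomial of its zeros in the disc of radius \<open>S\<close>. The quotient \<open>g\<close> has no zeros there, and by
  the maximum principle on the circle of radius \<open>2S\<close> it is bounded, relative to \<open>g 0\<close>, as well as
  \<open>f\<close> is relative to \<open>f 0\<close>. Then the logarithm of \<open>g\<close> has a real part bounded above, and by
  Borel--Caratheodory and Cauchy's estimates its derivative varies little near \<open>0\<close>: by
  \<open>O(log (M(2S)) / S\<^sup>2)\<close>, where \<open>M(2S)\<close> bounds \<open>\<bar>f\<bar>\<close> on that circle. Hence, if \<open>log \<bar>f v\<bar>\<close> is bounded
  above by \<open>o(\<bar>v\<bar>\<^sup>2)\<close>, the variation of \<open>f'/f\<close> between \<open>0\<close> and \<open>w\<close> is the limit of the sums over
  zeros in growing discs (lemma \<open>logderiv_partial_fractions\<close>). The values at \<open>0\<close> drop out of the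
  imaginary part, because \<open>f\<close> is real on the real axis.

  For \<open>H\<close>, the growth hypothesis reduces to the integrability of \<open>exp (\<tau> u\<^sup>2) \<Phi>(u)\<close> for every real
  \<open>\<tau>\<close>: the inequality \<open>\<bar>z\<bar> u \<le> \<epsilon> \<bar>z\<bar>\<^sup>2 + u\<^sup>2 / (4\<epsilon>)\<close> trades the growth of the cosine for a shift of \<open>\<tau>\<close>.
  Finally \<open>H 0\<close> is positive, since \<open>\<Phi>\<close> is positive on the half-line.
\<close>

section \<open>Zeros of entire functions\<close>

lemma zorder_entire_nonneg:
  assumes "f holomorphic_on UNIV" "f a \<noteq> 0"
  shows "zorder f \<rho> \<ge> 0"
proof -
  have "if f \<rho> = 0 then zorder f \<rho> > 0 else zorder f \<rho> = 0"
    using zorder_exist_zero[OF assms(1) open_UNIV connected_UNIV, of \<rho>] assms(2) by blast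
  then show ?thesis
    by (auto split: if_splits)
qed

text \<open>
  The order at \<open>\<rho>\<close> gives the factorization only near \<open>\<rho>\<close>; away from \<open>\<rho>\<close> the quotient is holomorphic
  anyway, so the local factor extends to the whole plane.
\<close>
lemma split_off_zero:
  assumes f: "f holomorphic_on UNIV" and nz: "f a \<noteq> 0"
  obtains g where "g holomorphic_on UNIV" "g \<rho> \<noteq> 0" "\<And>w. f w = g w * (w - \<rho>) ^ nat (zorder f \<rho>)"
proof -
  define n where "n = nat (zorder f \<rho>)"
  define u where "u = zor_poly f \<rho>"
  obtain r where r: "r > 0" "u holomorphic_on cball \<rho> r"
    and u: "\<And>w. w \<in> cball \<rho> r \<Longrightarrow> f w = u w * (w - \<rho>) ^ n \<and> u w \<noteq> 0"
    using zorder_exist_zero[OF f open_UNIV connected_UNIV, of \<rho>] nz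
    unfolding n_def u_def by blast
  define g where "g w = (if w = \<rho> then u \<rho> else f w / (w - \<rho>) ^ n)" for w
  have "g holomorphic_on (ball \<rho> r \<union> - {\<rho>})"
  proof (rule holomorphic_on_Un)
    show "g holomorphic_on ball \<rho> r"
      by (rule holomorphic_transform[of u]) (use r u in \<open>auto simp: g_def intro: holomorphic_on_subset\<close>)
    have "(\<lambda>w. f w / (w - \<rho>) ^ n) holomorphic_on - {\<rho>}"
      by (intro holomorphic_intros holomorphic_on_subset[OF f]) auto
    then show "g holomorphic_on - {\<rho>}"
      by (rule holomorphic_transform) (auto simp: g_def)
  qed auto
  moreover have "ball \<rho> r \<union> - {\<rho>} = UNIV"
    using r by auto
  moreover have "g \<rho> \<noteq> 0"
    using u[of \<rho>] r by (auto simp: g_def)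
  moreover have "f w = g w * (w - \<rho>) ^ n" for w
    using u[of \<rho>] r by (auto simp: g_def)
  ultimately show ?thesis
    using that[of g] unfolding n_def by simp
qed

text \<open>
  Zeros are split off one at a time. The orders in the statement are those of \<open>f\<close>, which agree with the
  orders of the successive quotients because the factors already removed do not vanish at the new point.
\<close>
lemma factor_finite_zeros:
  assumes "finite Z" and f: "f holomorphic_on UNIV" and nz: "f a \<noteq> 0"
  shows "\<exists>g. g holomorphic_on UNIV \<and> (\<forall>\<rho>\<in>Z. g \<rho> \<noteq> 0) \<and>
           (\<forall>w. f w = g w * (\<Prod>\<rho>\<in>Z. (w - \<rho>) ^ nat (zorder f \<rho>)))"
  using \<open>finite Z\<close>
proof (induction Z rule: finite_induct)
  case empty
  then show ?case using f by auto
next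
  case (insert \<rho> Z)
  define P where "P w = (\<Prod>\<rho>\<in>Z. (w - \<rho>) ^ nat (zorder f \<rho>))" for w
  obtain g where g: "g holomorphic_on UNIV" "\<And>\<rho>. \<rho> \<in> Z \<Longrightarrow> g \<rho> \<noteq> 0" "\<And>w. f w = g w * P w"
    using insert.IH unfolding P_def by blast
  have "g a \<noteq> 0"
    using nz g(3)[of a] by auto
  then obtain g' where g': "g' holomorphic_on UNIV" "g' \<rho> \<noteq> 0"
      "\<And>w. g w = g' w * (w - \<rho>) ^ nat (zorder g \<rho>)"
    using split_off_zero[OF g(1)] by metis
  have "P \<rho> \<noteq> 0"
    using insert.hyps unfolding P_def by auto
  define k where "k = nat (zorder g \<rho>)"
  have "P holomorphic_on UNIV"
    unfolding P_def by (intro holomorphic_intros)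
  then have "zorder f \<rho> = int k"
    using \<open>P \<rho> \<noteq> 0\<close> g'(2)
    by (intro zorder_eqI[of UNIV _ "\<lambda>w. g' w * P w"])
       (auto simp: g(3) g'(3) simp flip: k_def intro!: holomorphic_intros g'(1))
  then have "f w = g' w * (\<Prod>\<rho>\<in>insert \<rho> Z. (w - \<rho>) ^ nat (zorder f \<rho>))" for w
    using insert.hyps by (simp add: g(3) g'(3) flip: P_def k_def)
  moreover have "\<forall>\<sigma>\<in>insert \<rho> Z. g' \<sigma> \<noteq> 0"
    using g(2) g'(2,3) by (metis insert_iff mult_zero_left)
  ultimately show ?case
    using g'(1) by blast
qed

lemma has_field_derivative_prod_linear_powers:
  fixes w :: complex
  assumes "finite Z" "w \<notin> Z"
  shows "((\<lambda>w. \<Prod>\<rho>\<in>Z. (w - \<rho>) ^ m \<rho>) has_field_derivative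
           (\<Prod>\<rho>\<in>Z. (w - \<rho>) ^ m \<rho>) * (\<Sum>\<rho>\<in>Z. of_nat (m \<rho>) / (w - \<rho>))) (at w)"
  using assms
proof (induction Z rule: finite_induct)
  case empty
  then show ?case by simp
next
  case (insert \<rho> Z)
  have "w - \<rho> \<noteq> 0"
    using insert.prems by auto
  then have "of_nat (m \<rho>) * (w - \<rho>) ^ (m \<rho> - 1) = (w - \<rho>) ^ m \<rho> * (of_nat (m \<rho>) / (w - \<rho>))"
    by (cases "m \<rho>") auto
  moreover have "((\<lambda>w. (w - \<rho>) ^ m \<rho>) has_field_derivative of_nat (m \<rho>) * (w - \<rho>) ^ (m \<rho> - 1)) (at w)"
    by (auto intro!: derivative_eq_intros)
  ultimately have d: "((\<lambda>w. (w - \<rho>) ^ m \<rho>) has_field_derivative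
      (w - \<rho>) ^ m \<rho> * (of_nat (m \<rho>) / (w - \<rho>))) (at w)"
    by simp
  show ?case
    using DERIV_mult[OF d insert.IH] insert
    by (simp add: algebra_simps)
qed

lemma finite_zeros_cball:
  fixes f :: "complex \<Rightarrow> complex"
  assumes "f holomorphic_on UNIV" "f a \<noteq> 0"
  shows "finite {\<rho>. f \<rho> = 0 \<and> norm \<rho> \<le> R}"
proof (cases "f constant_on UNIV")
  case True
  then have "f \<rho> \<noteq> 0" for \<rho>
    using assms(2) by (auto simp: constant_on_def)
  then show ?thesis by simp
next
  case False
  have "{\<rho>. f \<rho> = 0 \<and> norm \<rho> \<le> R} = {\<rho> \<in> cball 0 R. f \<rho> = 0}"
    by auto
  then show ?thesis
    using holomorphic_compact_finite_zeros[OF assms(1) open_UNIV connected_UNIV compact_cball _ False]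
    by (metis subset_UNIV)
qed

text \<open>
  Conjugating the factorization of \<open>f\<close> at \<open>\<rho>\<close> gives its factorization at \<open>cnj \<rho>\<close>.
\<close>
lemma zorder_cnj:
  fixes f :: "complex \<Rightarrow> complex"
  assumes f: "f holomorphic_on UNIV" "f a \<noteq> 0" and real: "\<And>w. f (cnj w) = cnj (f w)"
  shows "zorder f (cnj \<rho>) = zorder f \<rho>"
proof -
  define n where "n = nat (zorder f \<rho>)"
  have n: "zorder f \<rho> = int n"
    using zorder_entire_nonneg[OF f] by (simp add: n_def)
  obtain g where g: "g holomorphic_on UNIV" "g \<rho> \<noteq> 0" "\<And>w. f w = g w * (w - \<rho>) ^ n"
    using split_off_zero[OF f, of \<rho>] unfolding n_def by metis
  have "zorder f (cnj \<rho>) = int n"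
  proof (rule zorder_eqI[of UNIV _ "cnj \<circ> g \<circ> cnj"])
    show "cnj \<circ> g \<circ> cnj holomorphic_on UNIV"
      by (intro holomorphic_on_compose_cnj_cnj holomorphic_on_subset[OF g(1)]) auto
    show "f w = (cnj \<circ> g \<circ> cnj) w * (w - cnj \<rho>) powi int n" for w
      using real[of "cnj w"] g(3)[of "cnj w"] by simp
  qed (use g(2) in auto)
  then show ?thesis
    using n by simp
qed

lemma deriv_real_at_0:
  fixes f :: "complex \<Rightarrow> complex"
  assumes f: "f holomorphic_on UNIV" and real: "\<And>w. f (cnj w) = cnj (f w)"
  shows "Im (deriv f 0) = 0"
proof -
  have "(f has_field_derivative deriv f 0) (at (cnj 0))"
    using holomorphic_derivI[OF f open_UNIV] by simp
  then have "(cnj \<circ> f \<circ> cnj has_field_derivative cnj (deriv f 0)) (at 0)"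
    by (rule has_field_derivative_cnj_cnj)
  moreover have "cnj \<circ> f \<circ> cnj = f"
    by (simp add: fun_eq_iff real)
  ultimately have "(f has_field_derivative cnj (deriv f 0)) (at 0)"
    by (simp only:)
  then have "deriv f 0 = cnj (deriv f 0)"
    by (rule DERIV_imp_deriv)
  then show ?thesis
    by (simp add: complex_eq_iff)
qed

section \<open>Partial fractions of the logarithmic derivative\<close>

text \<open>
  The function \<open>v \<mapsto> v / (2 A - v)\<close> maps the half-plane \<open>Re v < A\<close> into the unit disc and fixes \<open>0\<close>, so the
  Schwarz lemma applies to its composition with the rescaled \<open>h\<close>.
\<close>
lemma Borel_Caratheodory_half_radius:
  assumes h: "h holomorphic_on ball 0 S" "h 0 = 0" and S: "S > 0"
    and A: "\<And>w. norm w < S \<Longrightarrow> Re (h w) < A" and w: "norm w \<le> S / 2"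
  shows "norm (h w) \<le> 2 * A"
proof -
  have "A > 0" using A[of 0] h(2) S by simp
  define \<phi> where "\<phi> \<zeta> = h (S * \<zeta>) / (2 * A - h (S * \<zeta>))" for \<zeta> :: complex
  have inS: "norm (S * \<zeta>) < S" if "norm \<zeta> < 1" for \<zeta> :: complex
    using that S by (simp add: norm_mult)
  have less: "norm (h v) < norm (2 * A - h v)" if "norm v < S" for v
  proof -
    have "(norm (2 * A - h v))\<^sup>2 - (norm (h v))\<^sup>2 = 4 * A * (A - Re (h v))"
      unfolding cmod_power2 by (simp add: power2_eq_square algebra_simps)
    moreover have "\<dots> > 0"
      using A[OF that] \<open>A > 0\<close> by simp
    ultimately have "(norm (h v))\<^sup>2 < (norm (2 * A - h v))\<^sup>2"
      by linarith
    then show ?thesis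
      by (rule power2_less_imp_less) simp
  qed
  have hS: "(\<lambda>\<zeta>. h (S * \<zeta>)) holomorphic_on ball 0 1"
    by (rule holomorphic_on_compose_gen[of "\<lambda>\<zeta>. S * \<zeta>", OF _ h(1), unfolded o_def])
       (use inS in \<open>auto intro!: holomorphic_intros\<close>)
  have "norm (\<phi> (w / S)) \<le> norm (w / S)"
  proof (rule Schwarz_Lemma(1))
    show "\<phi> holomorphic_on ball 0 1"
      unfolding \<phi>_def using hS less inS by (intro holomorphic_intros) fastforce+
    show "\<phi> 0 = 0"
      by (simp add: \<phi>_def h)
    show "norm (\<phi> \<zeta>) < 1" if "norm \<zeta> < 1" for \<zeta>
    proof -
      have "norm (h (S * \<zeta>)) < norm (2 * A - h (S * \<zeta>))"
        using less inS that by blast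
      then show ?thesis
        unfolding \<phi>_def norm_divide
        by (metis divide_less_eq_1_pos norm_ge_zero order_le_less_trans)
    qed
    show "norm (w / S) < 1"
      using w S by (simp add: norm_divide)
  qed
  also have "\<dots> \<le> 1 / 2"
    using w S by (simp add: norm_divide)
  finally have "norm (h w) / norm (2 * A - h w) \<le> 1 / 2"
    using S by (simp add: \<phi>_def norm_divide)
  moreover have "norm (2 * A - h w) > 0"
    using less[of w] w S by (smt (verit) norm_ge_zero field_sum_of_halves)
  ultimately have "2 * norm (h w) \<le> norm (2 * A - h w)"
    by (simp add: field_simps)
  also have "\<dots> \<le> 2 * A + norm (h w)"
    using norm_triangle_ineq4[of "of_real (2 * A)" "h w"] \<open>A > 0\<close> by simp
  finally show ?thesis by simp
qed

text \<open>
  Let \<open>h\<close> be the logarithm of \<open>g / g 0\<close> with \<open>h 0 = 0\<close>. An upper bound on \<open>Re h\<close> bounds \<open>h\<close> on the disc of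
  half the radius, Cauchy's inequality on discs of radius \<open>S / 4\<close> then bounds \<open>h''\<close>, and \<open>h'\<close> is the
  logarithmic derivative of \<open>g\<close>.
\<close>
lemma logderiv_variation_bound:
  assumes g: "g holomorphic_on ball 0 S" and S: "S > 0"
    and nz: "\<And>w. norm w < S \<Longrightarrow> g w \<noteq> 0"
    and A: "\<And>w. norm w < S \<Longrightarrow> norm (g w) < exp A * norm (g 0)" and w: "norm w \<le> S / 4"
  shows "norm (deriv g w / g w - deriv g 0 / g 0) \<le> 64 * A / S\<^sup>2 * norm w"
proof -
  obtain k where k: "k holomorphic_on ball 0 S" "\<And>w. w \<in> ball 0 S \<Longrightarrow> g w = exp (k w)"
    using contractible_imp_holomorphic_log[OF g convex_imp_contractible[OF convex_ball]] nz by auto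
  define h where "h w = k w - k 0" for w
  have h: "h holomorphic_on ball 0 S"
    unfolding h_def by (intro holomorphic_intros k)
  have Re_h: "Re (h v) < A" if "norm v < S" for v
  proof -
    have "exp (Re (h v)) = norm (g v) / norm (g 0)"
      using k(2)[of v] k(2)[of 0] S that by (simp add: h_def exp_diff norm_divide flip: norm_exp_eq_Re)
    also have "\<dots> < exp A"
      using A[OF that] nz[of 0] S by (simp add: field_simps)
    finally show ?thesis by simp
  qed
  have dh: "deriv h v = deriv g v / g v" if "norm v < S" for v
  proof -
    have "(k has_field_derivative deriv k v) (at v)"
      using holomorphic_derivI[OF k(1)] that by auto
    then have dk: "((\<lambda>w. exp (k w)) has_field_derivative exp (k v) * deriv k v) (at v)"
      and "(h has_field_derivative deriv k v) (at v)"
      unfolding h_def by (auto intro!: derivative_eq_intros)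
    from dk have "(g has_field_derivative exp (k v) * deriv k v) (at v)"
      by (rule has_field_derivative_transform_within_open[of _ _ _ "ball 0 S"]) (use that k(2) in auto)
    then have "deriv g v = g v * deriv k v"
      using k(2) that by (simp add: DERIV_imp_deriv)
    moreover have "deriv h v = deriv k v"
      using \<open>(h has_field_derivative deriv k v) (at v)\<close> by (rule DERIV_imp_deriv)
    ultimately show ?thesis
      using nz[OF that] by simp
  qed
  have h'': "norm ((deriv ^^ 2) h v) \<le> fact 2 * (2 * A) / (S / 4)\<^sup>2" if "norm v \<le> S / 4" for v
  proof (rule Cauchy_inequality)
    have sub: "cball v (S / 4) \<subseteq> cball 0 (S / 2)"
      using that by (intro subsetI) (auto simp: dist_norm, smt (verit) norm_triangle_sub norm_minus_commute field_sum_of_halves)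
    moreover have "cball 0 (S / 2) \<subseteq> ball (0::complex) S"
      using S by auto
    ultimately have hc: "h holomorphic_on cball v (S / 4)"
      using h holomorphic_on_subset by blast
    then show "continuous_on (cball v (S / 4)) h" "h holomorphic_on ball v (S / 4)"
      by (auto simp: holomorphic_on_imp_continuous_on intro: holomorphic_on_subset)
    show "S / 4 > 0" using S by simp
    show "norm (h x) \<le> 2 * A" if "norm (v - x) = S / 4" for x
    proof (rule Borel_Caratheodory_half_radius[OF h _ S Re_h])
      have "x \<in> cball v (S / 4)"
        using that by (simp add: dist_norm)
      then show "norm x \<le> S / 2"
        using sub by auto
    qed (auto simp: h_def)
  qed
  have "norm (deriv h w - deriv h 0) \<le> fact 2 * (2 * A) / (S / 4)\<^sup>2 * norm (w - 0)"
  proof (rule field_differentiable_bound[of "cball 0 (S / 4)" "deriv h" "(deriv ^^ 2) h"])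
    show "(deriv h has_field_derivative (deriv ^^ 2) h v) (at v within cball 0 (S / 4))"
      if "v \<in> cball 0 (S / 4)" for v
    proof -
      have "deriv h holomorphic_on ball 0 S"
        using h by (simp add: holomorphic_deriv)
      then have "(deriv h has_field_derivative deriv (deriv h) v) (at v)"
        using that S by (intro holomorphic_derivI[of _ "ball 0 S"]) auto
      then show ?thesis
        by (simp add: numeral_2_eq_2 has_field_derivative_at_within)
    qed
  qed (use h'' w S in auto)
  then show ?thesis
    using dh[of w] dh[of 0] w S by (simp add: power2_eq_square fact_numeral)
qed

text \<open>
  The sum over the zeros in the disc of radius \<open>S\<close> is the change, between \<open>0\<close> and \<open>w\<close>, of the logarithmic
  derivative of the polynomial factor, so the error is the change of that of the quotient \<open>g\<close>. The growth of \<open>g\<close> is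
  controlled on the circle of radius \<open>2 S\<close>, where every removed zero is at least as far away as from the
  origin.
\<close>
lemma logderiv_truncation_error:
  fixes f :: "complex \<Rightarrow> complex"
  assumes f: "f holomorphic_on UNIV" and f0: "f 0 \<noteq> 0" and S: "S > 0"
    and M: "\<And>v. norm v = 2 * S \<Longrightarrow> norm (f v) \<le> M" and "M > 0"
    and w: "norm w \<le> S / 4" "f w \<noteq> 0"
  shows "norm ((\<Sum>\<rho>\<in>{\<rho>. f \<rho> = 0 \<and> norm \<rho> \<le> S}. of_int (zorder f \<rho>) * (1 / (w - \<rho>) + 1 / \<rho>))
           - (deriv f w / f w - deriv f 0 / f 0)) \<le> 64 * (ln (M / norm (f 0)) + 1) / S\<^sup>2 * norm w"
proof -
  define Z where "Z = {\<rho>. f \<rho> = 0 \<and> norm \<rho> \<le> S}"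
  define m where "m \<rho> = nat (zorder f \<rho>)" for \<rho>
  define P where "P w = (\<Prod>\<rho>\<in>Z. (w - \<rho>) ^ m \<rho>)" for w
  \<comment> \<open>The summand \<open>1\<close> turns the bound by \<open>M\<close> into the strict inequality needed for the Schwarz lemma.\<close>
  define A where "A = ln (M / norm (f 0)) + 1"
  have "finite Z"
    unfolding Z_def using f f0 by (rule finite_zeros_cball)
  obtain g where g: "g holomorphic_on UNIV" "\<And>\<rho>. \<rho> \<in> Z \<Longrightarrow> g \<rho> \<noteq> 0" "\<And>w. f w = g w * P w"
    using factor_finite_zeros[OF \<open>finite Z\<close> f f0] unfolding P_def m_def by blast
  have "g 0 \<noteq> 0" "P 0 \<noteq> 0"
    using f0 g(3)[of 0] by auto
  have bound: "norm (g v) \<le> M / norm (f 0) * norm (g 0)" if "norm v < 2 * S" for v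
  proof (rule maximum_modulus_frontier[of g "ball 0 (2 * S)"])
    fix u :: complex
    assume "u \<in> frontier (ball 0 (2 * S))"
    then have u: "norm u = 2 * S"
      using S by simp
    \<comment> \<open>On this circle \<open>norm (u - \<rho>) \<ge> 2 * S - norm \<rho> \<ge> S \<ge> norm \<rho>\<close> for every removed zero.\<close>
    have "norm (P 0) \<le> norm (P u)"
      unfolding P_def prod_norm[symmetric] norm_power
    proof (intro prod_mono conjI power_mono)
      fix \<rho> assume "\<rho> \<in> Z"
      then show "norm (0 - \<rho>) \<le> norm (u - \<rho>)"
        using u norm_triangle_ineq2[of u \<rho>] by (simp add: Z_def)
    qed auto
    then have "norm (g u) * norm (P 0) \<le> norm (f u)"
      by (simp add: g(3) norm_mult mult_left_mono)
    also have "\<dots> \<le> M"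
      using M u by simp
    finally have "norm (g u) * norm (P 0) \<le> M" .
    then show "norm (g u) \<le> M / norm (f 0) * norm (g 0)"
      using \<open>g 0 \<noteq> 0\<close> \<open>P 0 \<noteq> 0\<close> by (simp add: g(3) norm_mult field_simps)
  qed (use g(1) that in \<open>auto intro: holomorphic_on_subset holomorphic_on_imp_continuous_on\<close>)
  have "norm (deriv g w / g w - deriv g 0 / g 0) \<le> 64 * A / S\<^sup>2 * norm w"
  proof (rule logderiv_variation_bound)
    show "g holomorphic_on ball 0 S"
      using g(1) by (rule holomorphic_on_subset) simp
    show "g v \<noteq> 0" if "norm v < S" for v
      using g(2)[of v] g(3)[of v] that by (force simp: Z_def)
    show "norm (g v) < exp A * norm (g 0)" if "norm v < S" for v
    proof -
      have "exp A = exp 1 * (M / norm (f 0))"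
        unfolding A_def using f0 \<open>M > 0\<close> by (simp add: exp_add)
      moreover have "1 * (M / norm (f 0)) < exp 1 * (M / norm (f 0))"
        using f0 \<open>M > 0\<close> by (intro mult_strict_right_mono) auto
      ultimately have "M / norm (f 0) < exp A"
        by simp
      then have "M / norm (f 0) * norm (g 0) < exp A * norm (g 0)"
        using \<open>g 0 \<noteq> 0\<close> by (intro mult_strict_right_mono) auto
      then show ?thesis
        using bound[of v] that S by linarith
    qed
  qed (use S w in auto)
  moreover have logderiv: "deriv f v / f v = deriv g v / g v + (\<Sum>\<rho>\<in>Z. of_nat (m \<rho>) / (v - \<rho>))" if "f v \<noteq> 0" for v
  proof -
    have "v \<notin> Z"
      using that by (auto simp: Z_def)
    have "(g has_field_derivative deriv g v) (at v)"
      using g(1) by (intro holomorphic_derivI[of _ UNIV]) auto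
    moreover have "(P has_field_derivative P v * (\<Sum>\<rho>\<in>Z. of_nat (m \<rho>) / (v - \<rho>))) (at v)"
      using has_field_derivative_prod_linear_powers[OF \<open>finite Z\<close> \<open>v \<notin> Z\<close>] unfolding P_def .
    ultimately have "((\<lambda>v. g v * P v) has_field_derivative
        deriv g v * P v + P v * (\<Sum>\<rho>\<in>Z. of_nat (m \<rho>) / (v - \<rho>)) * g v) (at v)"
      by (rule DERIV_mult)
    then have "deriv f v = deriv g v * P v + P v * (\<Sum>\<rho>\<in>Z. of_nat (m \<rho>) / (v - \<rho>)) * g v"
      unfolding g(3)[symmetric] by (rule DERIV_imp_deriv)
    then show ?thesis
      using that by (simp add: g(3) field_simps)
  qed
  have "int (m \<rho>) = zorder f \<rho>" if "\<rho> \<in> Z" for \<rho>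
    using zorder_entire_nonneg[OF f f0] by (simp add: m_def)
  then have "complex_of_int (zorder f \<rho>) = of_nat (m \<rho>)" if "\<rho> \<in> Z" for \<rho>
    using that by (metis of_int_of_nat_eq)
  then have "(\<Sum>\<rho>\<in>Z. of_int (zorder f \<rho>) * (1 / (w - \<rho>) + 1 / \<rho>))
      = (\<Sum>\<rho>\<in>Z. of_nat (m \<rho>) / (w - \<rho>)) - (\<Sum>\<rho>\<in>Z. of_nat (m \<rho>) / (0 - \<rho>))"
    by (simp add: sum_subtractf[symmetric] sum.distrib[symmetric] ring_distribs)
  ultimately show ?thesis
    using logderiv[OF w(2)] logderiv[OF f0] unfolding Z_def[symmetric] A_def
    by (simp add: norm_minus_commute)
qed

text \<open>
  The growth hypothesis makes the truncation error at radius \<open>R\<close> tend to \<open>0\<close>: the logarithm of the bound on the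
  circle of radius \<open>2 R\<close> is \<open>4 \<epsilon> R\<^sup>2 + O(1)\<close> with \<open>\<epsilon>\<close> arbitrarily small, and it is divided by \<open>R\<^sup>2\<close>.
\<close>
lemma logderiv_partial_fractions:
  fixes f :: "complex \<Rightarrow> complex"
  assumes f: "f holomorphic_on UNIV" and f0: "f 0 \<noteq> 0"
    and growth: "\<And>\<epsilon>. \<epsilon> > 0 \<Longrightarrow> \<exists>C. \<forall>v. norm (f v) \<le> C * exp (\<epsilon> * (norm v)\<^sup>2)"
    and w: "f w \<noteq> 0"
  shows "((\<lambda>R. \<Sum>\<rho>\<in>{\<rho>. f \<rho> = 0 \<and> norm \<rho> \<le> R}. of_int (zorder f \<rho>) * (1 / (w - \<rho>) + 1 / \<rho>))
           \<longlongrightarrow> deriv f w / f w - deriv f 0 / f 0) at_top"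
proof (rule tendstoI)
  fix e :: real
  assume "e > 0"
  \<comment> \<open>The error bound at radius \<open>S\<close> tends to \<open>256 * \<epsilon> * norm w\<close>; this choice keeps that below \<open>e / 2\<close>.\<close>
  define \<epsilon> where "\<epsilon> = e / (512 * (norm w + 1))"
  have "\<epsilon> > 0"
    unfolding \<epsilon>_def using \<open>e > 0\<close> by (auto simp: add_nonneg_pos)
  then obtain C where C: "norm (f v) \<le> C * exp (\<epsilon> * (norm v)\<^sup>2)" for v
    using growth by blast
  have "C > 0"
    using C[of 0] f0 by (simp, metis norm_le_zero_iff less_le_trans not_le order.trans)
  define K where "K = ln C - ln (norm (f 0)) + 1"
  have "256 * \<epsilon> * norm w < e"
    using \<open>e > 0\<close> unfolding \<epsilon>_def by (simp add: field_simps add_pos_nonneg)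
  moreover have "((\<lambda>S. 64 * (4 * \<epsilon> * S\<^sup>2 + K) / S\<^sup>2 * norm w) \<longlongrightarrow> 256 * \<epsilon> * norm w) at_top"
    by real_asymp
  ultimately have "eventually (\<lambda>S. 64 * (4 * \<epsilon> * S\<^sup>2 + K) / S\<^sup>2 * norm w < e) at_top"
    by (rule order_tendstoD(2)[rotated])
  then show "eventually (\<lambda>R. dist (\<Sum>\<rho>\<in>{\<rho>. f \<rho> = 0 \<and> norm \<rho> \<le> R}. of_int (zorder f \<rho>) * (1 / (w - \<rho>) + 1 / \<rho>))
      (deriv f w / f w - deriv f 0 / f 0) < e) at_top"
    using eventually_ge_at_top[of "4 * norm w"] eventually_gt_at_top[of 0]
  proof eventually_elim
    case (elim S)
    define M where "M = C * exp (\<epsilon> * (2 * S)\<^sup>2)"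
    have "ln (M / norm (f 0)) + 1 = 4 * \<epsilon> * S\<^sup>2 + K"
      using \<open>C > 0\<close> f0 by (simp add: M_def K_def ln_div ln_mult power_mult_distrib)
    moreover have "M > 0"
      using \<open>C > 0\<close> unfolding M_def by simp
    moreover have "norm (f v) \<le> M" if "norm v = 2 * S" for v
      using C[of v] that unfolding M_def by simp
    ultimately show ?case
      using logderiv_truncation_error[OF f f0 \<open>0 < S\<close> _ _ _ w, of M] elim
      by (simp add: dist_norm)
  qed
qed

section \<open>The contribution of a conjugate pair of zeros\<close>

text \<open>
  The average of \<open>- Im (1 / (x + i\<eta> - \<sigma>))\<close> over \<open>\<sigma> = \<rho>\<close> and \<open>\<sigma> = cnj \<rho>\<close>.
\<close>
definition pair_kernel :: "real \<Rightarrow> real \<Rightarrow> complex \<Rightarrow> real" where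
  "pair_kernel x \<eta> \<rho> = ((\<eta> - Im \<rho>) / ((Re \<rho> - x)\<^sup>2 + (\<eta> - Im \<rho>)\<^sup>2)
     + (\<eta> + Im \<rho>) / ((Re \<rho> - x)\<^sup>2 + (\<eta> + Im \<rho>)\<^sup>2)) / 2"

text \<open>
  Write \<open>s = (Re \<rho> - x)\<^sup>2\<close>, \<open>c = (Im \<rho>)\<^sup>2\<close> and \<open>e = \<eta>\<^sup>2\<close>. After dividing by \<open>\<eta>\<close> and clearing denominators the difference of the two sides is
  \<open>s (e + 3 c - 4 y\<^sup>2) + (e - c) (e - c - 4 y\<^sup>2)\<close>, and \<open>e \<ge> 5 y\<^sup>2\<close>, \<open>c \<le> y\<^sup>2\<close> make each factor nonnegative. The constant
  \<open>sqrt 5\<close> is what \<open>e - c \<ge> 4 y\<^sup>2\<close> requires at full height \<open>c = y\<^sup>2\<close>.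
\<close>
lemma pair_kernel_le:
  assumes y: "\<bar>Im \<rho>\<bar> \<le> y" "y > 0" and \<eta>: "\<eta> \<ge> sqrt 5 * y"
  shows "pair_kernel x \<eta> \<rho> \<le> \<eta> / ((Re \<rho> - x)\<^sup>2 + 4 * y\<^sup>2)"
proof -
  define s where "s = (Re \<rho> - x)\<^sup>2"
  define c where "c = (Im \<rho>)\<^sup>2"
  define e where "e = \<eta>\<^sup>2"
  have "sqrt 5 * y \<ge> 1 * y" "sqrt 5 * y > y"
    using y by (auto simp: real_less_rsqrt)
  then have "\<eta> > y" "\<eta> > 0"
    using \<eta> y by linarith+
  have "(sqrt 5 * y)\<^sup>2 \<le> \<eta>\<^sup>2"
    using \<eta> y by (intro power_mono) auto
  then have e: "5 * y\<^sup>2 \<le> e"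
    by (simp add: e_def power_mult_distrib)
  have c: "0 \<le> c" "c \<le> y\<^sup>2"
    using y by (auto simp: c_def abs_le_square_iff[symmetric])
  have s: "s \<ge> 0"
    by (simp add: s_def)
  have p: "s + (\<eta> - Im \<rho>)\<^sup>2 > 0" "s + (\<eta> + Im \<rho>)\<^sup>2 > 0"
    using \<open>\<eta> > y\<close> y s by (auto intro!: add_nonneg_pos)
  have prod: "(s + (\<eta> - Im \<rho>)\<^sup>2) * (s + (\<eta> + Im \<rho>)\<^sup>2) = (s + e + c)\<^sup>2 - 4 * e * c"
    unfolding e_def c_def by (simp add: power2_eq_square algebra_simps)
  have "0 \<le> s * (e + 3 * c - 4 * y\<^sup>2) + (e - c) * (e - c - 4 * y\<^sup>2)"
    using s c e by (intro add_nonneg_nonneg mult_nonneg_nonneg) auto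
  also have "\<dots> = (s + e + c)\<^sup>2 - 4 * e * c - (s + e - c) * (s + 4 * y\<^sup>2)"
    by (simp add: power2_eq_square algebra_simps)
  finally have le: "(s + e - c) * (s + 4 * y\<^sup>2) \<le> (s + (\<eta> - Im \<rho>)\<^sup>2) * (s + (\<eta> + Im \<rho>)\<^sup>2)"
    by (simp add: prod)
  have num: "(\<eta> - Im \<rho>) * (s + (\<eta> + Im \<rho>)\<^sup>2) + (\<eta> + Im \<rho>) * (s + (\<eta> - Im \<rho>)\<^sup>2) = 2 * (\<eta> * (s + e - c))"
    by (simp add: e_def c_def power2_eq_square algebra_simps)
  have "s + (\<eta> - Im \<rho>)\<^sup>2 \<noteq> 0" "s + (\<eta> + Im \<rho>)\<^sup>2 \<noteq> 0"
    using p by linarith+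
  then have "pair_kernel x \<eta> \<rho> = \<eta> * ((s + e - c) / ((s + (\<eta> - Im \<rho>)\<^sup>2) * (s + (\<eta> + Im \<rho>)\<^sup>2)))"
    unfolding pair_kernel_def s_def[symmetric] by (simp add: add_frac_eq num)
  also have "(s + e - c) / ((s + (\<eta> - Im \<rho>)\<^sup>2) * (s + (\<eta> + Im \<rho>)\<^sup>2)) \<le> 1 / (s + 4 * y\<^sup>2)"
    using le p s y by (simp add: divide_simps mult_pos_pos add_nonneg_pos)
  finally show ?thesis
    using \<open>\<eta> > 0\<close> by (simp add: s_def)
qed

text \<open>
  This serves only to make the sum over all zeros converge, so the constant is crude: each half of the
  kernel has the form \<open>d / (s + d\<^sup>2)\<close> with \<open>\<eta> - y \<le> d \<le> \<eta> + y\<close>.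
\<close>
lemma pair_kernel_ge:
  assumes y: "\<bar>Im \<rho>\<bar> \<le> y" "y > 0" and \<eta>: "\<eta> > y"
  shows "(\<eta> - y) * (4 * y\<^sup>2) / (\<eta> + y)\<^sup>2 / ((Re \<rho> - x)\<^sup>2 + 4 * y\<^sup>2) \<le> pair_kernel x \<eta> \<rho>"
proof -
  define s where "s = (Re \<rho> - x)\<^sup>2"
  have half: "(\<eta> - y) * (4 * y\<^sup>2) / (\<eta> + y)\<^sup>2 / (s + 4 * y\<^sup>2) \<le> d / (s + d\<^sup>2)"
    if "\<eta> - y \<le> d" "d \<le> \<eta> + y" for d
  proof -
    have "d\<^sup>2 \<le> (\<eta> + y)\<^sup>2" "(2 * y)\<^sup>2 \<le> (\<eta> + y)\<^sup>2"
      using that y \<eta> by (intro power_mono; simp)+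
    then have "4 * y\<^sup>2 * (s + d\<^sup>2) \<le> (\<eta> + y)\<^sup>2 * (s + 4 * y\<^sup>2)"
      using mult_right_mono[of "(2 * y)\<^sup>2" "(\<eta> + y)\<^sup>2" s] mult_left_mono[of "d\<^sup>2" "(\<eta> + y)\<^sup>2" "4 * y\<^sup>2"]
      by (simp add: s_def power_mult_distrib algebra_simps)
    then have "4 * y\<^sup>2 / ((\<eta> + y)\<^sup>2 * (s + 4 * y\<^sup>2)) \<le> 1 / (s + d\<^sup>2)"
      using that y \<eta> by (simp add: divide_simps add_nonneg_pos s_def)
    then have "(\<eta> - y) * (4 * y\<^sup>2 / ((\<eta> + y)\<^sup>2 * (s + 4 * y\<^sup>2))) \<le> d * (1 / (s + d\<^sup>2))"
      using that \<eta> y by (intro mult_mono) (auto simp: s_def)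
    then show ?thesis by simp
  qed
  have "(\<eta> - y) * (4 * y\<^sup>2) / (\<eta> + y)\<^sup>2 / (s + 4 * y\<^sup>2) \<le> (\<eta> - Im \<rho>) / (s + (\<eta> - Im \<rho>)\<^sup>2)"
    using y by (intro half) auto
  moreover have "(\<eta> - y) * (4 * y\<^sup>2) / (\<eta> + y)\<^sup>2 / (s + 4 * y\<^sup>2) \<le> (\<eta> + Im \<rho>) / (s + (\<eta> + Im \<rho>)\<^sup>2)"
    using y by (intro half) auto
  moreover have "r \<le> (a + b) / 2" if "r \<le> a" "r \<le> b" for r a b :: real
    using that by simp
  ultimately show ?thesis
    unfolding pair_kernel_def s_def by blast
qed

lemma pair_kernel_at_height:
  assumes "Re \<rho> = x" "\<eta> \<noteq> Im \<rho>" "\<eta> \<noteq> - Im \<rho>"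
  shows "pair_kernel x \<eta> \<rho> = \<eta> / (\<eta>\<^sup>2 - (Im \<rho>)\<^sup>2)"
proof -
  have "\<eta>\<^sup>2 - (Im \<rho>)\<^sup>2 = (\<eta> - Im \<rho>) * (\<eta> + Im \<rho>)"
    by (simp add: power2_eq_square algebra_simps)
  moreover have "\<eta> - Im \<rho> \<noteq> 0" "\<eta> + Im \<rho> \<noteq> 0"
    using assms by auto
  ultimately show ?thesis
    using assms(1) unfolding pair_kernel_def by (simp add: power2_eq_square add_frac_eq)
qed

section \<open>The height sum of a real entire function\<close>

text \<open>
  Discs centred at \<open>0\<close> contain \<open>cnj \<rho>\<close> along with \<open>\<rho>\<close>. Hence in every truncated sum the terms \<open>1 / \<rho>\<close> add
  up to a real number, and the remaining terms may be averaged over conjugate pairs.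
\<close>
lemma Im_logderiv_tendsto:
  fixes f :: "complex \<Rightarrow> complex"
  assumes f: "f holomorphic_on UNIV" and f0: "f 0 \<noteq> 0"
    and growth: "\<And>\<epsilon>. \<epsilon> > 0 \<Longrightarrow> \<exists>C. \<forall>v. norm (f v) \<le> C * exp (\<epsilon> * (norm v)\<^sup>2)"
    and real: "\<And>w. f (cnj w) = cnj (f w)"
    and nz: "f (Complex x \<eta>) \<noteq> 0"
  shows "((\<lambda>R. \<Sum>\<rho>\<in>{\<rho>. f \<rho> = 0 \<and> norm \<rho> \<le> R}. of_int (zorder f \<rho>) * pair_kernel x \<eta> \<rho>)
           \<longlongrightarrow> - Im (deriv f (Complex x \<eta>) / f (Complex x \<eta>))) at_top"
proof -
  define w where "w = Complex x \<eta>"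
  define k where "k \<rho> = (\<eta> - Im \<rho>) / ((Re \<rho> - x)\<^sup>2 + (\<eta> - Im \<rho>)\<^sup>2)" for \<rho>
  have "Im (f 0) = 0"
    using real[of 0] by (simp add: complex_eq_iff)
  then have "Im (deriv f 0 / f 0) = 0"
    using deriv_real_at_0[OF f real] by (simp add: Im_divide)
  then have Im_diff: "- Im (v - deriv f 0 / f 0) = - Im v" for v
    by simp
  have "((\<lambda>R. \<Sum>\<rho>\<in>{\<rho>. f \<rho> = 0 \<and> norm \<rho> \<le> R}. of_int (zorder f \<rho>) * (1 / (w - \<rho>) + 1 / \<rho>))
           \<longlongrightarrow> deriv f w / f w - deriv f 0 / f 0) at_top"
    by (rule logderiv_partial_fractions[OF f f0 growth]) (use nz w_def in simp_all)
  from tendsto_minus[OF tendsto_Im[OF this]]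
  have lim: "((\<lambda>R. - Im (\<Sum>\<rho>\<in>{\<rho>. f \<rho> = 0 \<and> norm \<rho> \<le> R}. of_int (zorder f \<rho>) * (1 / (w - \<rho>) + 1 / \<rho>)))
           \<longlongrightarrow> - Im (deriv f w / f w)) at_top"
    unfolding Im_diff .
  have truncation: "- Im (\<Sum>\<rho>\<in>{\<rho>. f \<rho> = 0 \<and> norm \<rho> \<le> R}. of_int (zorder f \<rho>) * (1 / (w - \<rho>) + 1 / \<rho>))
      = (\<Sum>\<rho>\<in>{\<rho>. f \<rho> = 0 \<and> norm \<rho> \<le> R}. of_int (zorder f \<rho>) * pair_kernel x \<eta> \<rho>)" for R
  proof -
    define Z where "Z = {\<rho>. f \<rho> = 0 \<and> norm \<rho> \<le> R}"
    define m where "m \<rho> = real_of_int (zorder f \<rho>)" for \<rho>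
    have reflect: "(\<Sum>\<rho>\<in>Z. m \<rho> * h \<rho>) = (\<Sum>\<rho>\<in>Z. m \<rho> * h (cnj \<rho>))" for h
      by (rule sum.reindex_bij_witness[of _ cnj cnj])
         (auto simp: Z_def m_def real zorder_cnj[OF f f0 real])
    have "(\<Sum>\<rho>\<in>Z. m \<rho> * Im (1 / \<rho>)) = (\<Sum>\<rho>\<in>Z. m \<rho> * Im (1 / cnj \<rho>))"
      by (rule reflect)
    also have "\<dots> = - (\<Sum>\<rho>\<in>Z. m \<rho> * Im (1 / \<rho>))"
      by (simp add: Im_divide sum_negf)
    finally have 0: "(\<Sum>\<rho>\<in>Z. m \<rho> * Im (1 / \<rho>)) = 0"
      by simp
    have "Im (of_int (zorder f \<rho>) * (1 / (w - \<rho>) + 1 / \<rho>)) = m \<rho> * Im (1 / \<rho>) - m \<rho> * k \<rho>" for \<rho>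
    proof -
      have "Im (1 / (w - \<rho>)) = - k \<rho>"
        by (simp add: Im_divide k_def w_def power2_commute[of x] minus_divide_left del: divide_minus_left)
      moreover have "Im (of_int (zorder f \<rho>) * (1 / (w - \<rho>) + 1 / \<rho>)) = m \<rho> * (Im (1 / (w - \<rho>)) + Im (1 / \<rho>))"
        by (simp add: m_def)
      ultimately show ?thesis
        by (simp add: right_diff_distrib)
    qed
    then have "- Im (\<Sum>\<rho>\<in>Z. of_int (zorder f \<rho>) * (1 / (w - \<rho>) + 1 / \<rho>))
        = (\<Sum>\<rho>\<in>Z. m \<rho> * k \<rho>) - (\<Sum>\<rho>\<in>Z. m \<rho> * Im (1 / \<rho>))"
      unfolding Im_sum by (simp only: sum_subtractf minus_diff_eq)
    also have "\<dots> = ((\<Sum>\<rho>\<in>Z. m \<rho> * k \<rho>) + (\<Sum>\<rho>\<in>Z. m \<rho> * k (cnj \<rho>))) / 2"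
      using 0 reflect[of k] by simp
    also have "\<dots> = (\<Sum>\<rho>\<in>Z. m \<rho> * pair_kernel x \<eta> \<rho>)"
      unfolding sum.distrib[symmetric] sum_divide_distrib
      by (intro sum.cong refl) (simp add: pair_kernel_def k_def ring_distribs)
    finally show ?thesis
      by (simp add: Z_def m_def)
  qed
  show ?thesis
    using lim unfolding truncation unfolding w_def .
qed

text \<open>
  The limit formula for the imaginary part of the logarithmic derivative has nonnegative terms. Hence its
  value bounds all finite partial sums, which yields summability, and it is itself at most the
  contribution of the distinguished pair plus \<open>\<eta>\<close> times the full sum over the other zeros.
\<close>
lemma height_sum_lower_bound:
  fixes f :: "complex \<Rightarrow> complex"
  assumes f: "f holomorphic_on UNIV" and f0: "f 0 \<noteq> 0"
    and growth: "\<And>\<epsilon>. \<epsilon> > 0 \<Longrightarrow> \<exists>C. \<forall>v. norm (f v) \<le> C * exp (\<epsilon> * (norm v)\<^sup>2)"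
    and real: "\<And>w. f (cnj w) = cnj (f w)"
    and z: "f (Complex x y) = 0" "zorder f (Complex x y) = 1" and "y > 0"
    and strip: "\<And>\<rho>. f \<rho> = 0 \<Longrightarrow> \<bar>Im \<rho>\<bar> \<le> y"
    and \<eta>: "\<eta> \<ge> sqrt 5 * y"
  shows "f (Complex x \<eta>) \<noteq> 0" (is ?nz)
    and "- Im (deriv f (Complex x \<eta>) / f (Complex x \<eta>)) / \<eta> - 2 / (\<eta>\<^sup>2 - y\<^sup>2)
      \<le> (\<Sum>\<^sub>\<infinity>\<rho>\<in>{\<rho>. f \<rho> = 0} - {Complex x y, cnj (Complex x y)}.
            real_of_int (zorder f \<rho>) / ((Re \<rho> - x)\<^sup>2 + 4 * y\<^sup>2))" (is ?bound)
proof -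
  define z where "z = Complex x y"
  define \<Lambda> where "\<Lambda> = - Im (deriv f (Complex x \<eta>) / f (Complex x \<eta>))"
  define Z where "Z R = {\<rho>. f \<rho> = 0 \<and> norm \<rho> \<le> R}" for R
  define m where "m \<rho> = real_of_int (zorder f \<rho>)" for \<rho>
  define q where "q \<rho> = m \<rho> / ((Re \<rho> - x)\<^sup>2 + 4 * y\<^sup>2)" for \<rho>
  define c where "c = (\<eta> - y) * (4 * y\<^sup>2) / (\<eta> + y)\<^sup>2"
  have "y < sqrt 5 * y"
    using \<open>y > 0\<close> by (simp add: real_less_rsqrt)
  then have "\<eta> > y"
    using \<eta> by linarith
  then have "c > 0"
    using \<open>y > 0\<close> by (simp add: c_def)
  show ?nz
    using strip[of "Complex x \<eta>"] \<open>\<eta> > y\<close> by auto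
  have fin: "finite (Z R)" for R
    unfolding Z_def using f f0 by (rule finite_zeros_cball)
  have m: "m \<rho> \<ge> 0" for \<rho>
    using zorder_entire_nonneg[OF f f0] by (simp add: m_def)
  have q: "q \<rho> \<ge> 0" for \<rho>
    using m by (simp add: q_def)
  have kernel_ge: "c * q \<rho> \<le> m \<rho> * pair_kernel x \<eta> \<rho>" if "f \<rho> = 0" for \<rho>
    using mult_left_mono[OF pair_kernel_ge[OF strip[OF that] \<open>y > 0\<close> \<open>\<eta> > y\<close>] m[of \<rho>], of x]
    by (simp add: c_def q_def mult_ac)
  have kernel_le: "m \<rho> * pair_kernel x \<eta> \<rho> \<le> \<eta> * q \<rho>" if "f \<rho> = 0" for \<rho>
    using mult_left_mono[OF pair_kernel_le[OF strip[OF that] \<open>y > 0\<close> \<eta>] m[of \<rho>], of x]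
    by (simp add: q_def mult_ac)
  have lim: "((\<lambda>R. \<Sum>\<rho>\<in>Z R. m \<rho> * pair_kernel x \<eta> \<rho>) \<longlongrightarrow> \<Lambda>) at_top"
    unfolding Z_def m_def \<Lambda>_def by (rule Im_logderiv_tendsto[OF f f0 growth real \<open>?nz\<close>])

  have partial: "sum q F \<le> \<Lambda> / c" if F: "F \<subseteq> {\<rho>. f \<rho> = 0}" "finite F" for F
  proof -
    obtain B where B: "\<And>\<rho>. \<rho> \<in> F \<Longrightarrow> norm \<rho> \<le> B"
      using finite_imp_bounded[OF F(2)] by (auto simp: bounded_iff)
    have "c * sum q F \<le> \<Lambda>"
    proof (rule tendsto_lowerbound[OF lim])
      show "eventually (\<lambda>R. c * sum q F \<le> (\<Sum>\<rho>\<in>Z R. m \<rho> * pair_kernel x \<eta> \<rho>)) at_top"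
        using eventually_ge_at_top[of B]
      proof eventually_elim
        case (elim R)
        have "c * sum q F \<le> c * sum q (Z R)"
          using B elim F \<open>c > 0\<close> q by (intro mult_left_mono sum_mono2 fin) (force simp: Z_def)+
        also have "\<dots> \<le> (\<Sum>\<rho>\<in>Z R. m \<rho> * pair_kernel x \<eta> \<rho>)"
          unfolding sum_distrib_left by (intro sum_mono kernel_ge) (simp add: Z_def)
        finally show ?case .
      qed
    qed simp
    then show ?thesis
      using \<open>c > 0\<close> by (simp add: field_simps)
  qed
  have summable: "q summable_on {\<rho>. f \<rho> = 0} - {z, cnj z}"
  proof (rule nonneg_bdd_above_summable_on)
    show "bdd_above (sum q ` {F. F \<subseteq> {\<rho>. f \<rho> = 0} - {z, cnj z} \<and> finite F})"
      by (rule bdd_aboveI[of _ "\<Lambda> / c"]) (use partial in blast)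
  qed (rule q)

  define G where "G = infsum q ({\<rho>. f \<rho> = 0} - {z, cnj z})"
  have "\<Lambda> \<le> 2 * (\<eta> / (\<eta>\<^sup>2 - y\<^sup>2)) + \<eta> * G"
  proof (rule tendsto_upperbound[OF lim])
    show "eventually (\<lambda>R. (\<Sum>\<rho>\<in>Z R. m \<rho> * pair_kernel x \<eta> \<rho>) \<le> 2 * (\<eta> / (\<eta>\<^sup>2 - y\<^sup>2)) + \<eta> * G) at_top"
      using eventually_ge_at_top[of "norm z"]
    proof eventually_elim
      case (elim R)
      have "z \<noteq> cnj z" "f (cnj z) = 0" "m z = 1" "m (cnj z) = 1"
        using \<open>y > 0\<close> z real[of z] zorder_cnj[OF f f0 real, of z] by (auto simp: z_def m_def complex_eq_iff)
      moreover have "{z, cnj z} \<subseteq> Z R"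
        using z elim \<open>f (cnj z) = 0\<close> by (auto simp: Z_def z_def)
      moreover have "pair_kernel x \<eta> z = \<eta> / (\<eta>\<^sup>2 - y\<^sup>2)" "pair_kernel x \<eta> (cnj z) = \<eta> / (\<eta>\<^sup>2 - y\<^sup>2)"
        using \<open>\<eta> > y\<close> \<open>y > 0\<close> by (subst pair_kernel_at_height; simp add: z_def)+
      ultimately have "(\<Sum>\<rho>\<in>Z R. m \<rho> * pair_kernel x \<eta> \<rho>)
          = (\<Sum>\<rho>\<in>Z R - {z, cnj z}. m \<rho> * pair_kernel x \<eta> \<rho>) + 2 * (\<eta> / (\<eta>\<^sup>2 - y\<^sup>2))"
        using sum.subset_diff[OF _ fin, of "{z, cnj z}" R "\<lambda>\<rho>. m \<rho> * pair_kernel x \<eta> \<rho>"] by simp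
      also have "(\<Sum>\<rho>\<in>Z R - {z, cnj z}. m \<rho> * pair_kernel x \<eta> \<rho>) \<le> \<eta> * sum q (Z R - {z, cnj z})"
        unfolding sum_distrib_left by (intro sum_mono kernel_le) (simp add: Z_def)
      also have "sum q (Z R - {z, cnj z}) \<le> G"
        unfolding G_def using fin q by (intro finite_sum_le_infsum summable) (auto simp: Z_def)
      finally show ?case
        using \<open>\<eta> > y\<close> \<open>y > 0\<close> by (simp add: mult_left_mono)
    qed
  qed simp
  then have "\<Lambda> / \<eta> \<le> (2 * (\<eta> / (\<eta>\<^sup>2 - y\<^sup>2)) + \<eta> * G) / \<eta>"
    using \<open>\<eta> > y\<close> \<open>y > 0\<close> by (intro divide_right_mono) auto
  also have "\<dots> = 2 / (\<eta>\<^sup>2 - y\<^sup>2) + G"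
    using \<open>\<eta> > y\<close> \<open>y > 0\<close> by (simp add: add_divide_distrib)
  finally show ?bound
    by (simp add: \<Lambda>_def G_def q_def[abs_def] m_def z_def)
qed

section \<open>The weight and the entire function it defines\<close>

definition Phi_term :: "nat \<Rightarrow> real \<Rightarrow> real" where
  "Phi_term k u = (2 * pi\<^sup>2 * real (Suc k) ^ 4 * exp (9 * u) - 3 * pi * (real (Suc k))\<^sup>2 * exp (5 * u))
     * exp (- pi * (real (Suc k))\<^sup>2 * exp (4 * u))"

lemma Phi_eq_suminf: "Phi u = (\<Sum>k. Phi_term k u)"
  by (simp add: Phi_def Phi_term_def Let_def)

lemma Phi_term_pos:
  assumes "u \<ge> 0"
  shows "Phi_term k u > 0"
proof -
  define n where "n = real (Suc k)"
  have "3 < 2 * pi" using pi_gt3 by simp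
  also have "\<dots> * 1 \<le> 2 * pi * (n\<^sup>2 * exp (4 * u))"
  proof (intro mult_left_mono)
    have "1 * 1 \<le> n\<^sup>2 * exp (4 * u)"
      using assms by (intro mult_mono one_le_power) (auto simp: n_def)
    then show "1 \<le> n\<^sup>2 * exp (4 * u)" by simp
  qed auto
  finally have "0 < pi * n\<^sup>2 * exp (5 * u) * (2 * pi * (n\<^sup>2 * exp (4 * u)) - 3) * exp (- pi * n\<^sup>2 * exp (4 * u))"
    by (intro mult_pos_pos) (auto simp: n_def)
  also have "exp (9 * u) = exp (5 * u) * exp (4 * u)"
    by (simp flip: exp_add)
  then have "pi * n\<^sup>2 * exp (5 * u) * (2 * pi * (n\<^sup>2 * exp (4 * u)) - 3) * exp (- pi * n\<^sup>2 * exp (4 * u)) = Phi_term k u"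
    unfolding Phi_term_def n_def[symmetric]
    by (simp add: algebra_simps power2_eq_square eval_nat_numeral)
  finally show ?thesis .
qed

text \<open>
  With \<open>n = Suc k\<close> and \<open>q = exp (4 u)\<close> both \<open>n\<^sup>2\<close> and \<open>q\<close> are at least \<open>1\<close>, so \<open>n\<^sup>2 q \<ge> (n\<^sup>2 + q) / 2\<close>. This separates
  the decay in \<open>k\<close> from the decay in \<open>u\<close>.
\<close>
lemma Phi_term_le:
  assumes "u \<ge> 0"
  shows "Phi_term k u \<le> (2 * pi\<^sup>2 * real (Suc k) ^ 4 * exp (- pi * (real (Suc k))\<^sup>2 / 2))
           * exp (9 * u - pi / 2 * exp (4 * u))"
proof -
  define n where "n = real (Suc k)"
  define q where "q = exp (4 * u)"
  have nq: "n\<^sup>2 \<ge> 1" "q \<ge> 1"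
    using assms by (auto simp: n_def q_def intro: one_le_power)
  then have "n\<^sup>2 * 1 \<le> n\<^sup>2 * q" "1 * q \<le> n\<^sup>2 * q"
    by (intro mult_left_mono mult_right_mono; simp)+
  then have "pi * ((n\<^sup>2 + q) / 2) \<le> pi * (n\<^sup>2 * q)"
    by (intro mult_left_mono) auto
  then have e: "exp (- pi * n\<^sup>2 * q) \<le> exp (- pi * n\<^sup>2 / 2) * exp (- (pi / 2 * q))"
    by (simp add: field_simps flip: exp_add)
  have "Phi_term k u \<le> 2 * pi\<^sup>2 * n ^ 4 * exp (9 * u) * exp (- pi * n\<^sup>2 * q)"
    unfolding Phi_term_def n_def[symmetric] q_def by (intro mult_right_mono) auto
  also have "\<dots> \<le> 2 * pi\<^sup>2 * n ^ 4 * exp (9 * u) * (exp (- pi * n\<^sup>2 / 2) * exp (- (pi / 2 * q)))"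
    using e by (intro mult_left_mono) auto
  also have "exp (- (pi / 2 * q)) = exp (9 * u - pi / 2 * q) / exp (9 * u)"
    by (simp flip: exp_diff)
  finally show ?thesis
    by (simp add: n_def q_def mult_ac)
qed

lemma Phi_bounds:
  obtains C where "\<And>u. u \<ge> 0 \<Longrightarrow> 0 < Phi u \<and> Phi u \<le> C * exp (9 * u - pi / 2 * exp (4 * u))"
proof -
  define c where "c k = 2 * pi\<^sup>2 * real (Suc k) ^ 4 * exp (- pi * (real (Suc k))\<^sup>2 / 2)" for k
  have "summable c"
  proof (rule summable_comparison_test_bigo)
    show "summable (\<lambda>k. norm (1 / real k ^ 2))"
      using inverse_power_summable[of 2, where 'a = real] by (simp add: field_simps)
    show "c \<in> O(\<lambda>k. 1 / real k ^ 2)"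
      unfolding c_def by real_asymp
  qed
  have "0 < Phi u \<and> Phi u \<le> suminf c * exp (9 * u - pi / 2 * exp (4 * u))" if "u \<ge> 0" for u
  proof -
    have le: "Phi_term k u \<le> c k * exp (9 * u - pi / 2 * exp (4 * u))" for k
      using Phi_term_le[OF that] by (simp add: c_def)
    have sm: "summable (\<lambda>k. c k * exp (9 * u - pi / 2 * exp (4 * u)))"
      using \<open>summable c\<close> by (rule summable_mult2)
    then have "summable (\<lambda>k. Phi_term k u)"
      by (rule summable_comparison_test'[where N = 0]) (use le Phi_term_pos[OF that] in \<open>simp add: less_imp_le\<close>)
    then show ?thesis
      using suminf_le[OF le _ sm] suminf_pos[OF _ Phi_term_pos[OF that]] suminf_mult2[OF \<open>summable c\<close>]
      by (simp add: Phi_eq_suminf)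
  qed
  then show ?thesis by (rule that)
qed

lemma integrable_exp_neg_Ici: "integrable lborel (\<lambda>u::real. indicator {0..} u * exp (- u))"
proof -
  have "(\<lambda>u::real. exp (- u)) absolutely_integrable_on {0..}"
    using integrable_on_exp_minus_to_infinity[of 1 0]
    by (intro nonnegative_absolutely_integrable_1) auto
  then show ?thesis
    by (subst integrable_completion[symmetric]) (auto simp: set_integrable_def)
qed

definition weight :: "real \<Rightarrow> real \<Rightarrow> real" where
  "weight \<tau> u = indicator {0..} u * (exp (\<tau> * u\<^sup>2) * Phi u)"

lemma Phi_pos: "u \<ge> 0 \<Longrightarrow> Phi u > 0"
  using Phi_bounds by blast

lemma weight_nonneg: "weight \<tau> u \<ge> 0"
  using Phi_pos[of u] by (cases "u \<ge> 0") (simp_all add: weight_def)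

lemma measurable_weight [measurable]: "weight \<tau> \<in> borel_measurable borel"
proof -
  have [measurable]: "Phi_term k \<in> borel_measurable borel" for k
    unfolding Phi_term_def by (intro borel_measurable_continuous_onI continuous_intros)
  have [measurable]: "Phi \<in> borel_measurable borel"
    unfolding Phi_eq_suminf[abs_def] by measurable
  show ?thesis
    unfolding weight_def by measurable
qed

text \<open>
  The double exponential decay of \<open>Phi\<close> beats every Gaussian factor; comparison with \<open>exp (- u)\<close> suffices.
\<close>
lemma integrable_weight: "integrable lborel (weight \<tau>)"
proof -
  obtain C where C: "\<And>u. u \<ge> 0 \<Longrightarrow> 0 < Phi u \<and> Phi u \<le> C * exp (9 * u - pi / 2 * exp (4 * u))"
    using Phi_bounds by blast
  \<comment> \<open>The exponent in the bound for the weight, with \<open>9 * u\<close> raised to \<open>10 * u\<close> to leave room for \<open>exp (- u)\<close>.\<close>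
  define f where "f u = \<tau> * u\<^sup>2 + 10 * u - pi / 2 * exp (4 * u)" for u
  have "((\<lambda>u::real. u\<^sup>2 / exp (4 * u)) \<longlongrightarrow> 0) at_top" "((\<lambda>u::real. u / exp (4 * u)) \<longlongrightarrow> 0) at_top"
    by real_asymp+
  then have "((\<lambda>u. \<tau> * (u\<^sup>2 / exp (4 * u)) + 10 * (u / exp (4 * u))) \<longlongrightarrow> \<tau> * 0 + 10 * 0) at_top"
    by (intro tendsto_intros)
  then have "eventually (\<lambda>u. \<tau> * (u\<^sup>2 / exp (4 * u)) + 10 * (u / exp (4 * u)) < pi / 2) at_top"
    by (rule order_tendstoD) simp
  then have "eventually (\<lambda>u. f u \<le> 0) at_top"
  proof eventually_elim
    case (elim u)
    have "f u = (\<tau> * (u\<^sup>2 / exp (4 * u)) + 10 * (u / exp (4 * u)) - pi / 2) * exp (4 * u)"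
      by (simp add: f_def ring_distribs)
    then show ?case
      using elim by (simp add: mult_nonpos_nonneg)
  qed
  then obtain N where N: "\<And>u. u \<ge> N \<Longrightarrow> f u \<le> 0"
    by (auto simp: eventually_at_top_linorder)
  have "compact (f ` {0..N})"
    unfolding f_def by (intro compact_continuous_image continuous_intros) auto
  then have "bdd_above (f ` {0..N})"
    by (intro bounded_imp_bdd_above compact_imp_bounded)
  then obtain B where "\<forall>y\<in>f ` {0..N}. y \<le> B"
    unfolding bdd_above_def ..
  then have B: "f u \<le> B" if "u \<in> {0..N}" for u
    using that by simp
  have fB: "f u \<le> max B 0" if "u \<ge> 0" for u
    using N[of u] B[of u] that by (cases "u \<le> N") (simp_all add: le_max_iff_disj)
  have le: "weight \<tau> u \<le> \<bar>C\<bar> * exp (max B 0) * (indicator {0..} u * exp (- u))" for u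
  proof (cases "u \<ge> 0")
    case True
    have "Phi u \<le> C * exp (9 * u - pi / 2 * exp (4 * u))"
      using C[OF True] by blast
    also have "\<dots> \<le> \<bar>C\<bar> * exp (9 * u - pi / 2 * exp (4 * u))"
      by (intro mult_right_mono) auto
    finally have "exp (\<tau> * u\<^sup>2) * Phi u \<le> exp (\<tau> * u\<^sup>2) * (\<bar>C\<bar> * exp (9 * u - pi / 2 * exp (4 * u)))"
      by (intro mult_left_mono) auto
    also have "\<dots> = \<bar>C\<bar> * exp (f u) * exp (- u)"
      by (simp add: f_def flip: exp_add)
    also have "\<dots> \<le> \<bar>C\<bar> * exp (max B 0) * exp (- u)"
      using fB[OF True] by (intro mult_right_mono mult_left_mono) auto
    finally show ?thesis
      using True by (simp add: weight_def)
  qed (simp add: weight_def)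
  show ?thesis
  proof (rule Bochner_Integration.integrable_bound)
    show "integrable lborel (\<lambda>u. \<bar>C\<bar> * exp (max B 0) * (indicator {0..} u * exp (- u)))"
      using integrable_exp_neg_Ici by (rule integrable_mult_right)
    show "AE u in lborel. norm (weight \<tau> u) \<le> norm (\<bar>C\<bar> * exp (max B 0) * (indicator {0..} u * exp (- u)))"
      using order_trans[OF le abs_ge_self] weight_nonneg by (intro AE_I2) simp
  qed simp
qed

text \<open>
  Young's inequality \<open>t \<bar>u\<bar> \<le> \<epsilon> t\<^sup>2 + u\<^sup>2 / (4 \<epsilon>)\<close> absorbs an exponential factor into a larger heat time. It
  supplies the domination for the power series of \<open>H\<close> as well as its growth bound.
\<close>
lemma weight_mult_exp_le:
  assumes "\<epsilon> > 0"
  shows "weight \<tau> u * exp (t * \<bar>u\<bar>) \<le> exp (\<epsilon> * t\<^sup>2) * weight (\<tau> + 1 / (4 * \<epsilon>)) u"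
proof -
  have "0 \<le> (2 * \<epsilon> * t - \<bar>u\<bar>)\<^sup>2 / (4 * \<epsilon>)"
    using assms by simp
  also have "\<dots> = \<epsilon> * t\<^sup>2 + 1 / (4 * \<epsilon>) * u\<^sup>2 - t * \<bar>u\<bar>"
    using assms by (simp add: power2_diff power_mult_distrib divide_simps) (simp add: power2_eq_square algebra_simps)
  finally have "exp (t * \<bar>u\<bar>) \<le> exp (\<epsilon> * t\<^sup>2) * exp (1 / (4 * \<epsilon>) * u\<^sup>2)"
    by (simp flip: exp_add)
  then have "weight \<tau> u * exp (t * \<bar>u\<bar>) \<le> weight \<tau> u * (exp (\<epsilon> * t\<^sup>2) * exp (1 / (4 * \<epsilon>) * u\<^sup>2))"
    using weight_nonneg by (rule mult_left_mono)
  also have "\<dots> = exp (\<epsilon> * t\<^sup>2) * weight (\<tau> + 1 / (4 * \<epsilon>)) u"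
    by (simp add: weight_def exp_add ring_distribs)
  finally show ?thesis .
qed

lemma integrable_weight_mult_exp: "integrable lborel (\<lambda>u. weight \<tau> u * exp (t * \<bar>u\<bar>))"
proof (rule Bochner_Integration.integrable_bound)
  show "integrable lborel (\<lambda>u. exp (1 * t\<^sup>2) * weight (\<tau> + 1 / (4 * 1)) u)"
    using integrable_weight by (rule integrable_mult_right)
  show "AE u in lborel. norm (weight \<tau> u * exp (t * \<bar>u\<bar>)) \<le> norm (exp (1 * t\<^sup>2) * weight (\<tau> + 1 / (4 * 1)) u)"
    using weight_mult_exp_le[of 1 \<tau> _ t] weight_nonneg by (intro AE_I2) (simp add: abs_mult)
qed simp

lemma H_eq_integral_weight: "H \<tau> z = (\<integral>u. of_real (weight \<tau> u) * cos (z * of_real u) \<partial>lborel)"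
  unfolding H_def set_lebesgue_integral_def weight_def
  by (intro Bochner_Integration.integral_cong) (auto simp: indicator_def)

text \<open>
  Expand the cosine and integrate term by term. The absolute partial sums are dominated by
  \<open>weight \<tau> u * exp (norm z * \<bar>u\<bar>)\<close>, which is integrable.
\<close>
lemma H_sums_power_series:
  "(\<lambda>k. (\<integral>u. of_real (weight \<tau> u) * (cos_coeff k *\<^sub>R of_real u ^ k) \<partial>lborel) * z ^ k) sums H \<tau> z"
proof -
  define f where "f k u = of_real (weight \<tau> u) * (cos_coeff k *\<^sub>R (z * of_real u) ^ k)" for k u
  have [measurable]: "f k \<in> borel_measurable borel" for k
    unfolding f_def by measurable
  have sum_norm_le: "(\<Sum>k<N. norm (f k u)) \<le> weight \<tau> u * exp (norm z * \<bar>u\<bar>)" for u N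
  proof -
    have "(\<Sum>k<N. norm (f k u)) \<le> (\<Sum>k<N. weight \<tau> u * ((norm z * \<bar>u\<bar>) ^ k /\<^sub>R fact k))"
    proof (rule sum_mono)
      fix k
      have "\<bar>cos_coeff k :: real\<bar> \<le> inverse (fact k)"
        by (simp add: cos_coeff_def power_abs field_simps)
      then have "weight \<tau> u * (\<bar>cos_coeff k\<bar> * (norm z * \<bar>u\<bar>) ^ k) \<le> weight \<tau> u * (inverse (fact k) * (norm z * \<bar>u\<bar>) ^ k)"
        by (intro mult_left_mono mult_right_mono weight_nonneg) auto
      then show "norm (f k u) \<le> weight \<tau> u * ((norm z * \<bar>u\<bar>) ^ k /\<^sub>R fact k)"
        unfolding f_def by (simp add: norm_mult norm_power weight_nonneg mult.left_commute)
    qed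
    also have "\<dots> = weight \<tau> u * (\<Sum>k<N. (norm z * \<bar>u\<bar>) ^ k /\<^sub>R fact k)"
      by (simp add: sum_distrib_left)
    also have "\<dots> \<le> weight \<tau> u * exp (norm z * \<bar>u\<bar>)"
      unfolding exp_def by (intro mult_left_mono sum_le_suminf summable_exp_generic weight_nonneg) auto
    finally show ?thesis .
  qed
  have int: "integrable lborel (f k)" for k
  proof (rule Bochner_Integration.integrable_bound[OF integrable_weight_mult_exp[of \<tau> "norm z"]])
    show "AE u in lborel. norm (f k u) \<le> norm (weight \<tau> u * exp (norm z * \<bar>u\<bar>))"
    proof (rule AE_I2)
      fix u
      have "norm (f k u) \<le> (\<Sum>k<Suc k. norm (f k u))"
        by (simp add: sum_nonneg)
      then show "norm (f k u) \<le> norm (weight \<tau> u * exp (norm z * \<bar>u\<bar>))"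
        using sum_norm_le[where N = "Suc k" and u = u] weight_nonneg[of \<tau> u] by (simp add: abs_mult)
    qed
  qed simp
  have "(\<lambda>k. integral\<^sup>L lborel (f k)) sums (\<integral>u. (\<Sum>k. f k u) \<partial>lborel)"
  proof (rule sums_integral[OF int])
    show "AE u in lborel. summable (\<lambda>k. norm (f k u))"
      by (intro AE_I2 summableI_nonneg_bounded[OF _ sum_norm_le]) simp
    show "summable (\<lambda>k. \<integral>u. norm (f k u) \<partial>lborel)"
    proof (rule summableI_nonneg_bounded)
      fix N
      have "(\<Sum>k<N. \<integral>u. norm (f k u) \<partial>lborel) = (\<integral>u. (\<Sum>k<N. norm (f k u)) \<partial>lborel)"
        using int by simp
      also have "\<dots> \<le> (\<integral>u. weight \<tau> u * exp (norm z * \<bar>u\<bar>) \<partial>lborel)"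
        using int by (intro integral_mono integrable_weight_mult_exp sum_norm_le) auto
      finally show "(\<Sum>k<N. \<integral>u. norm (f k u) \<partial>lborel) \<le> (\<integral>u. weight \<tau> u * exp (norm z * \<bar>u\<bar>) \<partial>lborel)" .
    qed simp
  qed
  moreover have "(\<Sum>k. f k u) = of_real (weight \<tau> u) * cos (z * of_real u)" for u
    unfolding f_def by (intro sums_unique[symmetric] sums_mult cos_converges)
  moreover have "integral\<^sup>L lborel (f k) = (\<integral>u. of_real (weight \<tau> u) * (cos_coeff k *\<^sub>R of_real u ^ k) \<partial>lborel) * z ^ k" for k
    unfolding f_def by (subst integral_mult_left_zero[symmetric]) (simp add: power_mult_distrib scaleR_conv_of_real mult_ac)
  ultimately show ?thesis
    by (simp add: H_eq_integral_weight)
qed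

lemma H_entire: "H \<tau> holomorphic_on UNIV"
proof -
  have "H \<tau> holomorphic_on ball 0 (norm z + 1)" for z :: complex
    by (rule power_series_holomorphic) (unfold diff_zero, rule H_sums_power_series)
  then have "H \<tau> field_differentiable at z" for z
    by (rule holomorphic_on_imp_differentiable_at[of _ "ball 0 (norm z + 1)"]) simp_all
  then show ?thesis
    by (simp add: holomorphic_on_def field_differentiable_at_within)
qed

lemma H_growth:
  assumes "\<epsilon> > 0"
  shows "\<exists>C. \<forall>z. norm (H \<tau> z) \<le> C * exp (\<epsilon> * (norm z)\<^sup>2)"
proof (intro exI allI)
  fix z :: complex
  define g where "g u = exp (\<epsilon> * (norm z)\<^sup>2) * weight (\<tau> + 1 / (4 * \<epsilon>)) u" for u
  have le: "norm (of_real (weight \<tau> u) * cos (z * of_real u)) \<le> g u" for u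
  proof -
    have "norm (of_real (weight \<tau> u) * cos (z * of_real u)) \<le> weight \<tau> u * exp (norm z * \<bar>u\<bar>)"
      using norm_cos_le[of "z * of_real u"] by (auto simp: norm_mult weight_nonneg intro!: mult_left_mono)
    also have "\<dots> \<le> g u"
      unfolding g_def using assms by (rule weight_mult_exp_le)
    finally show ?thesis .
  qed
  have g: "integrable lborel g"
    unfolding g_def using integrable_weight by (rule integrable_mult_right)
  have "integrable lborel (\<lambda>u. of_real (weight \<tau> u) * cos (z * of_real u))"
    by (rule Bochner_Integration.integrable_bound[OF g]) (use le in \<open>auto intro!: AE_I2 order_trans[OF le]\<close>)
  then have "norm (H \<tau> z) \<le> integral\<^sup>L lborel g"
    unfolding H_eq_integral_weight 
    by (intro Bochner_Integration.integral_norm_bound_integral[OF _ g]) (simp_all only: le)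
  then show "norm (H \<tau> z) \<le> (\<integral>u. weight (\<tau> + 1 / (4 * \<epsilon>)) u \<partial>lborel) * exp (\<epsilon> * (norm z)\<^sup>2)"
    unfolding g_def by (simp add: mult.commute[of _ "exp _"])
qed

lemma H_cnj: "H \<tau> (cnj z) = cnj (H \<tau> z)"
  unfolding H_eq_integral_weight Bochner_Integration.integral_cnj[symmetric] by (simp add: cnj_cos del: Bochner_Integration.integral_cnj)

lemma H_0_nonzero: "H \<tau> 0 \<noteq> 0"
proof
  assume "H \<tau> 0 = 0"
  then have "of_real (\<integral>u. weight \<tau> u \<partial>lborel) = (0 :: complex)"
    unfolding H_eq_integral_weight by simp
  then have "AE u in lborel. weight \<tau> u = 0"
    using integral_nonneg_eq_0_iff_AE[OF integrable_weight] weight_nonneg by auto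
  moreover have "u \<notin> {0..1}" if "weight \<tau> u = 0" for u
    using that Phi_pos[of u] by (auto simp: weight_def)
  ultimately have "AE u in lborel. u \<notin> {0..1::real}"
    by (auto elim: eventually_mono)
  then have "{0..1::real} \<in> null_sets lborel"
    by (simp add: AE_iff_null_sets)
  then show False
    by (simp add: null_sets_def)
qed

section \<open>The bound for the heat-flow family\<close>

theorem proposition2p3:
  fixes \<tau> x y \<eta> :: real and z :: complex
  assumes "z = Complex x y" and "y > 0"
    and "H \<tau> z = 0" and "zorder (H \<tau>) z = 1"
    and "\<And>\<rho>. H \<tau> \<rho> = 0 \<Longrightarrow> \<bar>Im \<rho>\<bar> \<le> y"
    and "\<eta> \<ge> sqrt 5 * y"
  shows "H \<tau> (Complex x \<eta>) \<noteq> 0 \<and>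
    G \<tau> z \<ge> L \<eta> \<tau> x / \<eta> - 2 / (\<eta>\<^sup>2 - y\<^sup>2) \<and>
    (\<forall>y0 G0. y \<le> y0 \<and> \<eta> \<ge> sqrt 5 * y0 \<and> G0 > 0 \<and>
        L \<eta> \<tau> x \<ge> \<eta> * (G0 + 2 / (\<eta>\<^sup>2 - y0\<^sup>2))
      \<longrightarrow> G \<tau> z \<ge> G0)"
proof (intro conjI allI impI)
  have z: "H \<tau> (Complex x y) = 0" "zorder (H \<tau>) (Complex x y) = 1"
    using assms by simp_all
  note bound = height_sum_lower_bound[OF H_entire H_0_nonzero H_growth H_cnj z \<open>y > 0\<close> assms(5,6)]
  show "H \<tau> (Complex x \<eta>) \<noteq> 0"
    by (rule bound(1))
  show G: "G \<tau> z \<ge> L \<eta> \<tau> x / \<eta> - 2 / (\<eta>\<^sup>2 - y\<^sup>2)"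
    using bound(2) unfolding G_def L_def assms(1) complex.sel by simp
  fix y0 G0 :: real
  assume *: "y \<le> y0 \<and> \<eta> \<ge> sqrt 5 * y0 \<and> G0 > 0 \<and> L \<eta> \<tau> x \<ge> \<eta> * (G0 + 2 / (\<eta>\<^sup>2 - y0\<^sup>2))"
  have "y0 < sqrt 5 * y0"
    using * \<open>y > 0\<close> by (simp add: real_less_rsqrt)
  then have "\<eta> > y0"
    using * by linarith
  have "y\<^sup>2 \<le> y0\<^sup>2" "y0\<^sup>2 < \<eta>\<^sup>2"
    using * \<open>y > 0\<close> \<open>\<eta> > y0\<close> by (auto intro: power_mono power_strict_mono)
  then have "2 / (\<eta>\<^sup>2 - y\<^sup>2) \<le> 2 / (\<eta>\<^sup>2 - y0\<^sup>2)"
    by (intro divide_left_mono mult_pos_pos) auto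
  moreover have "L \<eta> \<tau> x / \<eta> \<ge> G0 + 2 / (\<eta>\<^sup>2 - y0\<^sup>2)"
    using * \<open>y > 0\<close> \<open>\<eta> > y0\<close> by (simp add: le_divide_eq mult.commute)
  ultimately show "G \<tau> z \<ge> G0"
    using G by linarith
qed

end
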